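(* Let $r,s,t\ge 1$ be integers, and let $\mathbf{a}(z),\mathbf{b}(z)\in\mathbb{C}[z]^{r\times r}$ be matrix polynomials of degrees $s$ and $t$ respectively, with $\det\mathbf{a}(z)\not\equiv0$ and $\det\mathbf{b}(z)\not\equiv0$. Suppose there are matrices $\mathbf{D_A},\mathbf{A}\in\mathbb{C}^{rs\times rs}$, $\mathbf{X_A}\in\mathbb{C}^{r\times rs}$, $\mathbf{Y_A}\in\mathbb{C}^{rs\times r}$ with $$\det\mathbf{a}(z)=\det(z\mathbf{D_A}-\mathbf{A}),\qquad \mathbf{a}^{-1}(z)=\mathbf{X_A}(z\mathbf{D_A}-\mathbf{A})^{-1}\mathbf{Y_A}\ \text{ for } z\in\mathbb{C}\setminus\Lambda(\mathbf{a}),$$ and matrices $\mathbf{D_B},\mathbf{B}\in\mathbb{C}^{rt\times rt}$, $\mathbf{X_B}\in\mathbb{C}^{r\times rt}$, $\mathbf{Y_B}\in\mathbb{C}^{rt\times r}$ with $$\det\mathbf{b}(z)=\det(z\mathbf{D_B}-\mathbf{B}),\qquad \mathbf{b}^{-1}(z)=\mathbf{X_B}(z\mathbf{D_B}-\mathbf{B})^{-1}\mathbf{Y_B}\ \text{ for } z\in\mathbb{C}\setminus\Lambda(\mathbf{b}).$$ Let $\mathbf{c}_0,\mathbf{d}_0\in\mathbb{C}^{r\times r}$ and put $$\mathbf{H}=\begin{bmatrix}\mathbf{A}&\mathbf{0}&-\mathbf{Y_A}\mathbf{c}_0\mathbf{X_B}\\-\mathbf{X_A}&\mathbf{0}&\mathbf{0}\\\mathbf{0}&-\mathbf{Y_B}&\mathbf{B}\end{bmatrix},\quad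 \mathbf{D_H}=\begin{bmatrix}\mathbf{D_A}&\mathbf 0&\mathbf 0\\\mathbf 0&\mathbf{d}_0&\mathbf 0\\\mathbf 0&\mathbf 0&\mathbf{D_B}\end{bmatrix},\quad \mathbf{X_H}=\begin{bmatrix}\mathbf{0}&\mathbf{0}&\mathbf{X_B}\end{bmatrix},\quad \mathbf{Y_H}=\begin{bmatrix}\mathbf{Y_A}\\\mathbf{0}\\\mathbf{0}\end{bmatrix}.$$ Then $(\mathbf{H},\mathbf{D_H})$ linearizes $\mathbf{h}(z)=z\mathbf{a}(z)\mathbf{d}_0\mathbf{b}(z)+\mathbf{c}_0$; that is, $\det(z\mathbf{D_H}-\mathbf{H})=\det\mathbf{h}(z)$ for all $z$, and $$\mathbf{X_H}(z\mathbf{D_H}-\mathbf{H})^{-1}\mathbf{Y_H}=\mathbf{h}^{-1}(z)\qquad\text{for all } z\in\mathbb{C}\setminus\Lambda(\mathbf{h}).$$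
   Context: For a matrix polynomial $\mathbf{p}(z)\in\mathbb{C}[z]^{r\times r}$, $\Lambda(\mathbf{p})=\{z\in\mathbb{C}:\det\mathbf{p}(z)=0\}$ is its spectrum, and $\mathbf{p}^{-1}(z)=(\mathbf{p}(z))^{-1}$. *)

theory Defs
  imports
    Complex_Main
    "Jordan_Normal_Form.Determinant"
    "Jordan_Normal_Form.Gauss_Jordan_Elimination"
begin

(* A matrix polynomial is a matrix with polynomial entries; its degree is the largest degree of
   an entry, i.e. the largest k with nonzero coefficient matrix of z^k (and 0 for the zero matrix
   polynomial).  For a 0 x 0 matrix the value is unspecified. *)
definition mp_degree :: "complex poly mat \<Rightarrow> nat" where
  "mp_degree p = Max (degree ` elements_mat p)"

definition mp_eval :: "complex poly mat \<Rightarrow> complex \<Rightarrow> complex mat" where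
  "mp_eval p z = map_mat (\<lambda>q. poly q z) p"

definition mp_const :: "complex mat \<Rightarrow> complex poly mat" where
  "mp_const c = map_mat (\<lambda>x. [:x:]) c"

definition mp_spectrum :: "complex poly mat \<Rightarrow> complex set" where
  "mp_spectrum p = {z. det (mp_eval p z) = 0}"

(* Meaningful for invertible A only: mat_inverse A is None exactly when A has no inverse. *)
definition mat_inv :: "complex mat \<Rightarrow> complex mat" where
  "mat_inv A = the (mat_inverse A)"

(* Horizontal concatenation, the analogue of the library's vertical concatenation append_rows. *)
definition append_cols :: "'a :: zero mat \<Rightarrow> 'a mat \<Rightarrow> 'a mat" (infixr \<open>@\<^sub>c\<close> 66) where
  "A @\<^sub>c B = four_block_mat A B (0\<^sub>m 0 (dim_col A)) (0\<^sub>m 0 (dim_col B))"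

end

theory Submission
  imports Defs
begin

text \<open>
  Write \<open>P = z D_A - A\<close>, \<open>Q = z D_B - B\<close>. When \<open>z\<close> avoids the spectra of \<open>a\<close> and \<open>b\<close>, the blocks
  \<open>P\<close> and \<open>Q\<close> are invertible; eliminating them from \<open>z D_H - H\<close> leaves
  \<open>S = z d0 + a^-1 c0 b^-1\<close>, and \<open>a S b = h\<close> gives the determinant identity. The block column
  \<open>(P^-1 Y_A z a d0 b h^-1, -b h^-1, Q^-1 Y_B b h^-1)\<close> solves \<open>(z D_H - H) U = Y_H\<close>, and \<open>X_H U = h^-1\<close>.
  The finitely many exceptional \<open>z\<close> are covered by a polynomial identity: once determinants agree,
  the second claim reads \<open>X_H adj(z D_H - H) Y_H = adj h(z)\<close>, which extends from a cofinite set.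
\<close>

section \<open>Block matrices built by concatenation\<close>

lemma dim_append_rows [simp]:
  "dim_row (A @\<^sub>r B) = dim_row A + dim_row B" "dim_col (A @\<^sub>r B) = dim_col A"
  by (auto simp: append_rows_def)

lemma dim_append_cols [simp]:
  "dim_row (A @\<^sub>c B) = dim_row A" "dim_col (A @\<^sub>c B) = dim_col A + dim_col B"
  by (auto simp: append_cols_def)

lemma index_append_rows [simp]:
  assumes "i < dim_row A + dim_row B" "j < dim_col A" "dim_col B = dim_col A"
  shows "(A @\<^sub>r B) $$ (i, j) = (if i < dim_row A then A $$ (i, j) else B $$ (i - dim_row A, j))"
  using assms by (auto simp: append_rows_def)

lemma index_append_cols [simp]:
  assumes "i < dim_row A" "j < dim_col A + dim_col B" "dim_row B = dim_row A"
  shows "(A @\<^sub>c B) $$ (i, j) = (if j < dim_col A then A $$ (i, j) else B $$ (i, j - dim_col A))"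
  using assms by (auto simp: append_cols_def)

lemma append_rows_mult:
  fixes A :: "'a :: semiring_0 mat"
  assumes "dim_col B = dim_col A" "dim_row C = dim_col A"
  shows "(A @\<^sub>r B) * C = A * C @\<^sub>r B * C"
  by (rule eq_matI) (use assms in \<open>auto simp: scalar_prod_def\<close>)

lemma mult_append_cols:
  fixes A :: "'a :: semiring_0 mat"
  assumes "dim_row B = dim_col A" "dim_row C = dim_col A"
  shows "A * (B @\<^sub>c C) = A * B @\<^sub>c A * C"
  by (rule eq_matI) (use assms in \<open>auto simp: scalar_prod_def\<close>)

text \<open>Both factors are 2 x 2 block matrices with empty blocks, so the four-block product
  formula applies; its only nonempty block is the upper left one.\<close>

lemma append_cols_mult_append_rows:
  fixes A :: "'a :: semiring_0 mat"
  assumes "dim_row B = dim_row A" "dim_row C = dim_col A" "dim_row D = dim_col B" "dim_col D = dim_col C"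
  shows "(A @\<^sub>c B) * (C @\<^sub>r D) = A * C + B * D"
proof -
  have "(A @\<^sub>c B) * (C @\<^sub>r D) = four_block_mat (A * C + B * D) (0\<^sub>m (dim_row A) 0)
      (0\<^sub>m 0 (dim_col C)) (0\<^sub>m 0 0)"
    unfolding append_cols_def append_rows_def using assms
    by (subst mult_four_block_mat[of _ "dim_row A" "dim_col A" _ "dim_col B" _ 0 _ _ "dim_col C" _ 0])
      (auto intro!: cong_four_block_mat)
  also have "\<dots> = A * C + B * D"
    by (rule eq_matI) (use assms in auto)
  finally show ?thesis .
qed

lemma append_cols_add:
  assumes "dim_row C = dim_row A" "dim_col C = dim_col A" "dim_col D = dim_col B"
    "dim_row B = dim_row A" "dim_row D = dim_row A"
  shows "(A @\<^sub>c B) + (C @\<^sub>c D) = (A + C) @\<^sub>c (B + D)"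
  by (rule eq_matI) (use assms in auto)

lemma append_rows_minus:
  fixes A :: "'a :: group_add mat"
  assumes "dim_row C = dim_row A" "dim_col C = dim_col A" "dim_row D = dim_row B"
    "dim_col B = dim_col A" "dim_col D = dim_col A"
  shows "(A @\<^sub>r B) - (C @\<^sub>r D) = (A - C) @\<^sub>r (B - D)"
  by (rule eq_matI) (use assms in auto)

lemma append_cols_minus:
  fixes A :: "'a :: group_add mat"
  assumes "dim_row C = dim_row A" "dim_col C = dim_col A" "dim_col D = dim_col B"
    "dim_row B = dim_row A" "dim_row D = dim_row A"
  shows "(A @\<^sub>c B) - (C @\<^sub>c D) = (A - C) @\<^sub>c (B - D)"
  by (rule eq_matI) (use assms in auto)

lemma smult_append_rows:
  fixes A :: "'a :: mult_zero mat"
  assumes "dim_col B = dim_col A"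
  shows "k \<cdot>\<^sub>m (A @\<^sub>r B) = k \<cdot>\<^sub>m A @\<^sub>r k \<cdot>\<^sub>m B"
  by (rule eq_matI) (use assms in auto)

lemma smult_append_cols:
  fixes A :: "'a :: mult_zero mat"
  assumes "dim_row B = dim_row A"
  shows "k \<cdot>\<^sub>m (A @\<^sub>c B) = k \<cdot>\<^sub>m A @\<^sub>c k \<cdot>\<^sub>m B"
  by (rule eq_matI) (use assms in auto)

lemma append_zero_rows: "0\<^sub>m m n @\<^sub>r 0\<^sub>m k n = 0\<^sub>m (m + k) n"
  by (rule eq_matI) auto

lemma append_zero_cols: "0\<^sub>m m n @\<^sub>c 0\<^sub>m m k = 0\<^sub>m m (n + k)"
  by (rule eq_matI) auto

text \<open>Regroups the blocks as 1 + 2 by 1 + 2, so that determinant rules for 2 x 2 block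
  triangular matrices can be applied twice in succession.\<close>

lemma block3_eq_four_block_mat:
  assumes "A11 \<in> carrier_mat n1 m1" "A12 \<in> carrier_mat n1 m2" "A13 \<in> carrier_mat n1 m3"
    "A21 \<in> carrier_mat n2 m1" "A22 \<in> carrier_mat n2 m2" "A23 \<in> carrier_mat n2 m3"
    "A31 \<in> carrier_mat n3 m1" "A32 \<in> carrier_mat n3 m2" "A33 \<in> carrier_mat n3 m3"
  shows "(A11 @\<^sub>c A12 @\<^sub>c A13) @\<^sub>r (A21 @\<^sub>c A22 @\<^sub>c A23) @\<^sub>r (A31 @\<^sub>c A32 @\<^sub>c A33)
    = four_block_mat A11 (A12 @\<^sub>c A13) (A21 @\<^sub>r A31) (four_block_mat A22 A23 A32 A33)"
  by (rule eq_matI) (use assms in auto)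

section \<open>Inverses, adjugates and evaluation\<close>

text \<open>A left inverse \<open>B\<close> and the right inverse \<open>adj_mat A\<close> divided
  by \<open>det A\<close> coincide by associativity. In this form inversion is polynomial in the
  entries up to one scalar, which is what permits the passage to exceptional points.\<close>

lemma mat_inv_eq_adj_mat:
  assumes A: "A \<in> carrier_mat n n" and d: "det A \<noteq> 0"
  shows "mat_inv A = (1 / det A) \<cdot>\<^sub>m adj_mat A"
proof -
  note adj = adj_mat[OF A]
  obtain B where B: "mat_inverse A = Some B"
    using mat_inverse(1)[OF A] det_non_zero_imp_unit[OF A d] by fastforce
  from mat_inverse(2)[OF A this] have BA: "B * A = 1\<^sub>m n" and cB: "B \<in> carrier_mat n n" by auto
  have "B = B * (A * ((1 / det A) \<cdot>\<^sub>m adj_mat A))"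
    using A adj d cB by (subst mult_smult_distrib) (auto simp: adj(2) intro!: eq_matI)
  also have "\<dots> = (1 / det A) \<cdot>\<^sub>m adj_mat A"
    using A adj(1) cB BA by (subst assoc_mult_mat[symmetric]) auto
  finally show ?thesis using B by (simp add: mat_inv_def)
qed

lemma mat_inv:
  assumes A: "A \<in> carrier_mat n n" and d: "det A \<noteq> 0"
  shows "mat_inv A \<in> carrier_mat n n" "A * mat_inv A = 1\<^sub>m n" "mat_inv A * A = 1\<^sub>m n"
  using adj_mat[OF A] A d
  by (auto simp: mat_inv_eq_adj_mat[OF A d] mult_smult_distrib mult_smult_assoc_mat intro!: eq_matI)

interpretation poly_eval: comm_ring_hom "\<lambda>p. poly p (z :: 'a :: comm_ring_1)"
  by unfold_locales auto

lemma mp_eval_carrier [simp]: "mp_eval p z \<in> carrier_mat m n \<longleftrightarrow> p \<in> carrier_mat m n"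
  by (simp add: mp_eval_def)

lemma mp_eval_add:
  "p \<in> carrier_mat m n \<Longrightarrow> q \<in> carrier_mat m n \<Longrightarrow> mp_eval (p + q) z = mp_eval p z + mp_eval q z"
  unfolding mp_eval_def by (rule eq_matI) auto

lemma mp_eval_smult: "mp_eval (c \<cdot>\<^sub>m p) z = poly c z \<cdot>\<^sub>m mp_eval p z"
  unfolding mp_eval_def by (rule eq_matI) auto

lemma mp_eval_mult:
  "p \<in> carrier_mat m k \<Longrightarrow> q \<in> carrier_mat k n \<Longrightarrow> mp_eval (p * q) z = mp_eval p z * mp_eval q z"
  unfolding mp_eval_def by (rule poly_eval.mat_hom_mult)

lemma mp_eval_const [simp]: "mp_eval (mp_const c) z = c"
  unfolding mp_eval_def mp_const_def by (rule eq_matI) auto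

lemma mp_const_carrier [simp]: "mp_const c \<in> carrier_mat m n \<longleftrightarrow> c \<in> carrier_mat m n"
  by (simp add: mp_const_def)

lemma det_mp_eval: "det (mp_eval p z) = poly (det p) z"
  unfolding mp_eval_def by (rule poly_eval.hom_det)

text \<open>The entries of the adjugate are signed minors, and evaluation commutes with deleting a
  row and a column and with \<open>det\<close>.\<close>

lemma adj_mat_mp_eval:
  assumes "p \<in> carrier_mat n n"
  shows "adj_mat (mp_eval p z) = mp_eval (adj_mat p) z"
proof (rule eq_matI)
  fix i j assume "i < dim_row (mp_eval (adj_mat p) z)" "j < dim_col (mp_eval (adj_mat p) z)"
  hence ij: "i < n" "j < n" using assms adj_mat(1)[OF assms] by (auto simp: mp_eval_def)
  have "mat_delete (mp_eval p z) j i = mp_eval (mat_delete p j i) z"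
    unfolding mp_eval_def mat_delete_def using assms ij by (intro eq_matI) auto
  thus "adj_mat (mp_eval p z) $$ (i, j) = mp_eval (adj_mat p) z $$ (i, j)"
    using assms ij det_mp_eval[of "mat_delete p j i" z]
    by (auto simp: adj_mat_def cofactor_def mp_eval_def)
qed (use assms in \<open>auto simp: adj_mat_def mp_eval_def\<close>)

text \<open>Otherwise \<open>S\<close> and the finitely many roots of \<open>p - q\<close> would
  cover an infinite domain.\<close>

lemma poly_eqI_cofinite:
  fixes p q :: "'a :: {idom, ring_char_0} poly"
  assumes "finite S" "\<And>z. z \<notin> S \<Longrightarrow> poly p z = poly q z"
  shows "p = q"
proof (rule ccontr)
  assume "p \<noteq> q"
  hence "finite {z. poly (p - q) z = 0}" by (intro poly_roots_finite) auto
  hence "finite (S \<union> {z. poly (p - q) z = 0})" using assms(1) by auto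
  moreover have "S \<union> {z. poly (p - q) z = 0} = UNIV" using assms(2) by auto
  ultimately show False by (metis infinite_UNIV_char_0)
qed

lemma mp_eqI_cofinite:
  assumes "p \<in> carrier_mat m n" "q \<in> carrier_mat m n" "finite S"
    and eq: "\<And>z. z \<notin> S \<Longrightarrow> mp_eval p z = mp_eval q z"
  shows "p = q"
proof (rule eq_matI)
  fix i j assume "i < dim_row q" "j < dim_col q"
  hence ij: "i < m" "j < n" using assms by auto
  show "p $$ (i, j) = q $$ (i, j)"
  proof (rule poly_eqI_cofinite[OF \<open>finite S\<close>])
    fix z assume "z \<notin> S"
    thus "poly (p $$ (i, j)) z = poly (q $$ (i, j)) z"
      using arg_cong[OF eq, of z "\<lambda>X. X $$ (i, j)"] ij assms by (auto simp: mp_eval_def)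
  qed
qed (use assms in auto)


section \<open>Determinants and products of 3 x 3 block matrices\<close>

text \<open>The first block column splits off \<open>A11\<close>, and the remaining 2 x 2 part is
  block lower triangular. This is the shape of the multiplier \<open>N\<close> in
  \<open>det_block_pencil\<close>.\<close>

lemma det_block3_lower_left_zero:
  fixes A11 :: "'a :: idom mat"
  assumes "A11 \<in> carrier_mat n1 n1" "A12 \<in> carrier_mat n1 n2" "A13 \<in> carrier_mat n1 n3"
    "A22 \<in> carrier_mat n2 n2" "A32 \<in> carrier_mat n3 n2" "A33 \<in> carrier_mat n3 n3"
  shows "det ((A11 @\<^sub>c A12 @\<^sub>c A13) @\<^sub>r (0\<^sub>m n2 n1 @\<^sub>c A22 @\<^sub>c 0\<^sub>m n2 n3) @\<^sub>r (0\<^sub>m n3 n1 @\<^sub>c A32 @\<^sub>c A33))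
    = det A11 * (det A22 * det A33)"
proof -
  have "det (four_block_mat A11 (A12 @\<^sub>c A13) (0\<^sub>m n2 n1 @\<^sub>r 0\<^sub>m n3 n1) (four_block_mat A22 (0\<^sub>m n2 n3) A32 A33))
      = det A11 * det (four_block_mat A22 (0\<^sub>m n2 n3) A32 A33)"
    using assms by (intro det_four_block_mat_lower_left_zero[where m = "n2 + n3"])
      (auto simp: append_zero_rows)
  also have "det (four_block_mat A22 (0\<^sub>m n2 n3) A32 A33) = det A22 * det A33"
    using assms by (intro det_four_block_mat_upper_right_zero) auto
  finally show ?thesis
    using assms by (subst block3_eq_four_block_mat) auto
qed

text \<open>Here the first block row splits off \<open>A11\<close> and leaves a block upper
  triangular part, the shape of \<open>M * N\<close> in \<open>det_block_pencil\<close>.\<close>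

lemma det_block3_upper_right_zero:
  fixes A11 :: "'a :: idom mat"
  assumes "A11 \<in> carrier_mat n1 n1" "A21 \<in> carrier_mat n2 n1" "A31 \<in> carrier_mat n3 n1"
    "A22 \<in> carrier_mat n2 n2" "A23 \<in> carrier_mat n2 n3" "A33 \<in> carrier_mat n3 n3"
  shows "det ((A11 @\<^sub>c 0\<^sub>m n1 n2 @\<^sub>c 0\<^sub>m n1 n3) @\<^sub>r (A21 @\<^sub>c A22 @\<^sub>c A23) @\<^sub>r (A31 @\<^sub>c 0\<^sub>m n3 n2 @\<^sub>c A33))
    = det A11 * (det A22 * det A33)"
proof -
  have "det (four_block_mat A11 (0\<^sub>m n1 n2 @\<^sub>c 0\<^sub>m n1 n3) (A21 @\<^sub>r A31) (four_block_mat A22 A23 (0\<^sub>m n3 n2) A33))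
      = det A11 * det (four_block_mat A22 A23 (0\<^sub>m n3 n2) A33)"
    using assms by (intro det_four_block_mat_upper_right_zero[where m = "n2 + n3"])
      (auto simp: append_zero_cols)
  also have "det (four_block_mat A22 A23 (0\<^sub>m n3 n2) A33) = det A22 * det A33"
    using assms by (intro det_four_block_mat_lower_left_zero) auto
  finally show ?thesis
    using assms by (subst block3_eq_four_block_mat) auto
qed

lemma block3_mult_append_rows:
  fixes A11 :: "'a :: semiring_0 mat"
  assumes "A11 \<in> carrier_mat n1 m1" "A12 \<in> carrier_mat n1 m2" "A13 \<in> carrier_mat n1 m3"
    "A21 \<in> carrier_mat n2 m1" "A22 \<in> carrier_mat n2 m2" "A23 \<in> carrier_mat n2 m3"
    "A31 \<in> carrier_mat n3 m1" "A32 \<in> carrier_mat n3 m2" "A33 \<in> carrier_mat n3 m3"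
    "u \<in> carrier_mat m1 k" "v \<in> carrier_mat m2 k" "w \<in> carrier_mat m3 k"
  shows "((A11 @\<^sub>c A12 @\<^sub>c A13) @\<^sub>r (A21 @\<^sub>c A22 @\<^sub>c A23) @\<^sub>r (A31 @\<^sub>c A32 @\<^sub>c A33)) * (u @\<^sub>r v @\<^sub>r w)
    = (A11 * u + (A12 * v + A13 * w)) @\<^sub>r (A21 * u + (A22 * v + A23 * w)) @\<^sub>r (A31 * u + (A32 * v + A33 * w))"
  using assms by (simp add: append_rows_mult append_cols_mult_append_rows)

text \<open>This rule and the next ones replace carrier premises by equations between dimensions:
  every variable then occurs in the left-hand side, and the rules serve as conditional rewrite
  rules.\<close>

lemma mult_assoc_dim:
  fixes A :: "'a :: semiring_0 mat"
  shows "dim_row B = dim_col A \<Longrightarrow> dim_row C = dim_col B \<Longrightarrow> A * B * C = A * (B * C)"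
  by (rule assoc_mult_mat) auto

lemma mult_add_dim:
  fixes A :: "'a :: semiring_0 mat"
  shows "dim_row B = dim_col A \<Longrightarrow> dim_row C = dim_col A \<Longrightarrow> dim_col C = dim_col B \<Longrightarrow>
    A * (B + C) = A * B + A * C"
  by (rule mult_add_distrib_mat) auto

lemma add_mult_dim:
  fixes A :: "'a :: semiring_0 mat"
  shows "dim_row B = dim_row A \<Longrightarrow> dim_col B = dim_col A \<Longrightarrow> dim_row C = dim_col A \<Longrightarrow>
    (A + B) * C = A * C + B * C"
  by (rule add_mult_distrib_mat) auto

lemma add_zero_dim:
  fixes A :: "'a :: monoid_add mat"
  shows "dim_row A = m \<Longrightarrow> dim_col A = n \<Longrightarrow> 0\<^sub>m m n + A = A"
    "dim_row A = m \<Longrightarrow> dim_col A = n \<Longrightarrow> A + 0\<^sub>m m n = A"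
  by (auto intro!: eq_matI)

lemma uminus_zero_mat: "- 0\<^sub>m m n = (0\<^sub>m m n :: 'a :: group_add mat)"
  by (rule eq_matI) auto

lemma add_uminus_mat:
  fixes A :: "'a :: group_add mat"
  shows "A + - A = 0\<^sub>m (dim_row A) (dim_col A)" "- A + A = 0\<^sub>m (dim_row A) (dim_col A)"
  by (auto intro!: eq_matI)

lemma minus_zero_dim:
  fixes A :: "'a :: group_add mat"
  shows "dim_row A = m \<Longrightarrow> dim_col A = n \<Longrightarrow> A - 0\<^sub>m m n = A"
    "dim_row A = m \<Longrightarrow> dim_col A = n \<Longrightarrow> 0\<^sub>m m n - - A = A"
  by (auto intro!: eq_matI)

lemma mult_uminus_dim:
  fixes A :: "'a :: ring mat"
  shows "dim_row B = dim_col A \<Longrightarrow> A * (- B) = - (A * B)"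
  by (rule eq_matI) auto

section \<open>The block pencil at a fixed point\<close>

text \<open>The values at one \<open>z\<close> outside both spectra: \<open>P\<close> and
  \<open>Q\<close> stand for the two given pencils, \<open>E\<close> for \<open>z\<close> times
  \<open>d0\<close>, \<open>M\<close> for the pencil of \<open>H\<close>, and \<open>Pi\<close>,
  \<open>Qi\<close>, \<open>ai\<close>, \<open>bi\<close> for inverses. The factor \<open>z\<close>
  of \<open>h\<close> is absorbed into \<open>E\<close>.\<close>

context
  fixes P Pi Q Qi X Y X' Y' a ai b bi c E h M :: "'a :: idom mat" and r m n :: nat
  assumes carrier [simp]: "P \<in> carrier_mat m m" "Pi \<in> carrier_mat m m"
      "Q \<in> carrier_mat n n" "Qi \<in> carrier_mat n n"
      "X \<in> carrier_mat r m" "Y \<in> carrier_mat m r" "X' \<in> carrier_mat r n" "Y' \<in> carrier_mat n r"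
      "a \<in> carrier_mat r r" "ai \<in> carrier_mat r r" "b \<in> carrier_mat r r" "bi \<in> carrier_mat r r"
      "c \<in> carrier_mat r r" "E \<in> carrier_mat r r"
    and inv: "P * Pi = 1\<^sub>m m" "Q * Qi = 1\<^sub>m n" "a * ai = 1\<^sub>m r" "ai * a = 1\<^sub>m r" "bi * b = 1\<^sub>m r"
    and ai: "ai = X * Pi * Y" and bi: "bi = X' * Qi * Y'"
    and h: "h = a * E * b + c"
    and M: "M = (P @\<^sub>c 0\<^sub>m m r @\<^sub>c Y * c * X') @\<^sub>r (X @\<^sub>c E @\<^sub>c 0\<^sub>m r n) @\<^sub>r (0\<^sub>m n m @\<^sub>c Y' @\<^sub>c Q)"
begin

lemma block_dims [simp]:
  "dim_row P = m" "dim_col P = m" "dim_row Pi = m" "dim_col Pi = m"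
  "dim_row Q = n" "dim_col Q = n" "dim_row Qi = n" "dim_col Qi = n"
  "dim_row X = r" "dim_col X = m" "dim_row Y = m" "dim_col Y = r"
  "dim_row X' = r" "dim_col X' = n" "dim_row Y' = n" "dim_col Y' = r"
  "dim_row a = r" "dim_col a = r" "dim_row ai = r" "dim_col ai = r"
  "dim_row b = r" "dim_col b = r" "dim_row bi = r" "dim_col bi = r"
  "dim_row c = r" "dim_col c = r" "dim_row E = r" "dim_col E = r"
  using carrier by (auto simp only: carrier_matD)

text \<open>Products are normalised by nesting to the right, so inverse pairs have to cancel in
  front of a trailing factor.\<close>

lemma block_mult_cancel:
  "dim_row Z = m \<Longrightarrow> P * (Pi * Z) = Z" "dim_row W = n \<Longrightarrow> Q * (Qi * W) = W"
  "dim_row V = r \<Longrightarrow> a * (ai * V) = V" "dim_row V = r \<Longrightarrow> ai * (a * V) = V"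
  "dim_row V = r \<Longrightarrow> bi * (b * V) = V"
  by (subst mult_assoc_dim[symmetric]; simp add: inv)+

lemma realization_mult:
  "dim_row V = r \<Longrightarrow> X * (Pi * (Y * V)) = ai * V"
  "dim_row V = r \<Longrightarrow> X' * (Qi * (Y' * V)) = bi * V"
  "X * (Pi * Y) = ai" "X' * (Qi * Y') = bi"
  by (simp_all add: ai bi mult_assoc_dim)

text \<open>Right multiplication by \<open>N\<close> clears the blocks of \<open>M\<close> in such a way that only block triangular
  determinants remain.\<close>
lemma det_block_pencil:
  assumes dP: "det P = det a" and dQ: "det Q = det b"
  shows "det M = det h"
proof -
  define G where "G = Y * c * X'"
  \<comment> \<open>The Schur complement left after eliminating \<open>P\<close> and
    \<open>Q\<close>.\<close>
  define S where "S = E + ai * c * bi"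
  \<comment> \<open>Column 3 times \<open>Qi * Y'\<close> is subtracted from column 2 to clear
    \<open>Y'\<close>, and column 1 times \<open>Pi * G\<close> from column 3 to clear
    \<open>G\<close>. The block \<open>Pi * G * Qi * Y'\<close> removes the term that the first
    operation leaves in row 1.\<close>
  define N where "N = (1\<^sub>m m @\<^sub>c Pi * G * Qi * Y' @\<^sub>c - (Pi * G)) @\<^sub>r
    (0\<^sub>m r m @\<^sub>c 1\<^sub>m r @\<^sub>c 0\<^sub>m r n) @\<^sub>r (0\<^sub>m n m @\<^sub>c - (Qi * Y') @\<^sub>c 1\<^sub>m n)"
  have G [simp]: "dim_row G = m" "dim_col G = n" by (simp_all add: G_def)
  have S [simp]: "dim_row S = r" "dim_col S = r" by (simp_all add: S_def)
  have Mc: "M \<in> carrier_mat (m + (r + n)) (m + (r + n))" and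
    Nc: "N \<in> carrier_mat (m + (r + n)) (m + (r + n))"
    unfolding M N_def by (rule carrier_matI; simp)+
  have "S = ai * c * bi + E"
    unfolding S_def by (rule comm_add_mat[of _ r r]) (auto intro!: carrier_matI)
  hence XS: "X * (Pi * (G * (Qi * Y'))) + E = S"
    by (simp add: G_def realization_mult mult_assoc_dim)
  have "M * N = (P @\<^sub>c 0\<^sub>m m r @\<^sub>c 0\<^sub>m m n) @\<^sub>r (X @\<^sub>c S @\<^sub>c - (X * (Pi * G))) @\<^sub>r (0\<^sub>m n m @\<^sub>c 0\<^sub>m n r @\<^sub>c Q)"
    unfolding M N_def G_def[symmetric]
    by (subst block3_mult_append_rows[where ?n1.0 = m and ?n2.0 = r and ?n3.0 = n and
        ?m1.0 = m and ?m2.0 = r and ?m3.0 = n and k = "m + (r + n)"])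
      (simp_all add: carrier_matI mult_append_cols append_cols_add block_mult_cancel mult_assoc_dim
        mult_uminus_dim add_zero_dim uminus_zero_mat add_uminus_mat XS)
  hence "det M * det N = det P * (det S * det Q)"
    unfolding det_mult[OF Mc Nc, symmetric]
    by (simp only:, intro det_block3_upper_right_zero carrier_matI) simp_all
  moreover have "det N = 1"
    unfolding N_def by (subst det_block3_lower_left_zero) (auto intro!: carrier_matI)
  \<comment> \<open>By \<open>dP\<close> and \<open>dQ\<close> the left side equals
    \<open>det P * det S * det Q\<close>. In \<open>a * S * b\<close> the outer factors cancel
    \<open>ai\<close> and \<open>bi\<close>, which leaves \<open>h\<close>.\<close>
  moreover have "det a * det S * det b = det (a * S * b)"
    using det_mult[of "a * S" r b] det_mult[of a r S] by (simp add: carrier_matI)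
  moreover have "a * S * b = h"
    by (simp add: S_def h mult_add_dim add_mult_dim block_mult_cancel mult_assoc_dim inv)
  ultimately show ?thesis using dP dQ by (metis mult.assoc mult.right_neutral)
qed

text \<open>With middle block \<open>- (b * hi)\<close>, row 3 of \<open>M * U\<close> vanishes by
  the choice of \<open>w\<close>, and row 2 because \<open>X * Pi * Y * a\<close> is the identity.
  Row 1 collapses to \<open>Y * (h * hi)\<close>, since
  \<open>X' * w = bi * b * hi = hi\<close>.\<close>

lemma block_pencil_solution:
  assumes hi: "hi \<in> carrier_mat r r" "h * hi = 1\<^sub>m r"
  defines "w \<equiv> Qi * (Y' * (b * hi))"
  defines "U \<equiv> (Pi * (Y * (a * (E * (b * hi))))) @\<^sub>r - (b * hi) @\<^sub>r w"
  shows "M * U = Y @\<^sub>r 0\<^sub>m r r @\<^sub>r 0\<^sub>m n r" "(0\<^sub>m r m @\<^sub>c 0\<^sub>m r r @\<^sub>c X') * U = hi"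
    "U \<in> carrier_mat (m + (r + n)) r"
proof -
  have [simp]: "dim_row hi = r" "dim_col hi = r" using hi(1) by auto
  have "a * (E * (b * hi)) + c * hi = 1\<^sub>m r"
    using hi(2) by (simp add: h add_mult_dim mult_assoc_dim)
  hence "Y * (a * (E * (b * hi))) + Y * (c * hi) = Y"
    by (subst mult_add_dim[symmetric]) auto
  thus "M * U = Y @\<^sub>r 0\<^sub>m r r @\<^sub>r 0\<^sub>m n r"
    unfolding M U_def w_def
    by (subst block3_mult_append_rows[where ?n1.0 = m and ?n2.0 = r and ?n3.0 = n and
        ?m1.0 = m and ?m2.0 = r and ?m3.0 = n and k = r])
      (simp_all add: carrier_matI realization_mult block_mult_cancel mult_assoc_dim
        mult_uminus_dim add_zero_dim add_uminus_mat uminus_zero_mat)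
  show "(0\<^sub>m r m @\<^sub>c 0\<^sub>m r r @\<^sub>c X') * U = hi"
    unfolding U_def w_def
    by (simp add: append_cols_mult_append_rows realization_mult block_mult_cancel mult_uminus_dim uminus_zero_mat add_zero_dim)
  show "U \<in> carrier_mat (m + (r + n)) r"
    unfolding U_def w_def by (rule carrier_matI) simp_all
qed

end

section \<open>Linearization of \<open>h\<close> at all points\<close>

text \<open>Brings the pencil to the shape required of \<open>M\<close>: the subtraction absorbs the
  minus signs of the off-diagonal blocks.\<close>

lemma pencil_eq_block:
  fixes z :: "'a :: comm_ring_1"
  assumes "DA \<in> carrier_mat m m" "A \<in> carrier_mat m m" "X \<in> carrier_mat r m" "Y \<in> carrier_mat n r"
    "DB \<in> carrier_mat n n" "B \<in> carrier_mat n n" "G \<in> carrier_mat m n" "d \<in> carrier_mat r r"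
  shows "z \<cdot>\<^sub>m ((DA @\<^sub>c 0\<^sub>m m r @\<^sub>c 0\<^sub>m m n) @\<^sub>r (0\<^sub>m r m @\<^sub>c d @\<^sub>c 0\<^sub>m r n) @\<^sub>r (0\<^sub>m n m @\<^sub>c 0\<^sub>m n r @\<^sub>c DB))
      - ((A @\<^sub>c 0\<^sub>m m r @\<^sub>c - G) @\<^sub>r (- X @\<^sub>c 0\<^sub>m r r @\<^sub>c 0\<^sub>m r n) @\<^sub>r (0\<^sub>m n m @\<^sub>c - Y @\<^sub>c B))
    = ((z \<cdot>\<^sub>m DA - A) @\<^sub>c 0\<^sub>m m r @\<^sub>c G) @\<^sub>r (X @\<^sub>c z \<cdot>\<^sub>m d @\<^sub>c 0\<^sub>m r n) @\<^sub>r (0\<^sub>m n m @\<^sub>c Y @\<^sub>c (z \<cdot>\<^sub>m DB - B))"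
  using assms
  by (simp add: smult_append_rows smult_append_cols append_rows_minus append_cols_minus minus_zero_dim)

theorem theorem5:
  fixes r s t :: nat
    and a b h :: "complex poly mat"
    and DA A XA YA DB B XB YB c0 d0 H DH XH YH :: "complex mat"
  assumes "r \<ge> 1" and "s \<ge> 1" and "t \<ge> 1"
    and "a \<in> carrier_mat r r" and "mp_degree a = s" and "det a \<noteq> 0"
    and "b \<in> carrier_mat r r" and "mp_degree b = t" and "det b \<noteq> 0"
    and "DA \<in> carrier_mat (r * s) (r * s)" and "A \<in> carrier_mat (r * s) (r * s)"
    and "XA \<in> carrier_mat r (r * s)" and "YA \<in> carrier_mat (r * s) r"
    and "\<And>z. det (mp_eval a z) = det (z \<cdot>\<^sub>m DA - A)"
    and "\<And>z. z \<notin> mp_spectrum a \<Longrightarrow> mat_inv (mp_eval a z) = XA * mat_inv (z \<cdot>\<^sub>m DA - A) * YA"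
    and "DB \<in> carrier_mat (r * t) (r * t)" and "B \<in> carrier_mat (r * t) (r * t)"
    and "XB \<in> carrier_mat r (r * t)" and "YB \<in> carrier_mat (r * t) r"
    and "\<And>z. det (mp_eval b z) = det (z \<cdot>\<^sub>m DB - B)"
    and "\<And>z. z \<notin> mp_spectrum b \<Longrightarrow> mat_inv (mp_eval b z) = XB * mat_inv (z \<cdot>\<^sub>m DB - B) * YB"
    and "c0 \<in> carrier_mat r r" and "d0 \<in> carrier_mat r r"
    and "H = (A                @\<^sub>c 0\<^sub>m (r * s) r @\<^sub>c - (YA * c0 * XB)) @\<^sub>r
             (- XA             @\<^sub>c 0\<^sub>m r r       @\<^sub>c 0\<^sub>m r (r * t)  ) @\<^sub>r
             (0\<^sub>m (r * t) (r * s) @\<^sub>c - YB        @\<^sub>c B               )"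
    and "DH = (DA                  @\<^sub>c 0\<^sub>m (r * s) r @\<^sub>c 0\<^sub>m (r * s) (r * t)) @\<^sub>r
              (0\<^sub>m r (r * s)       @\<^sub>c d0           @\<^sub>c 0\<^sub>m r (r * t)      ) @\<^sub>r
              (0\<^sub>m (r * t) (r * s) @\<^sub>c 0\<^sub>m (r * t) r @\<^sub>c DB                 )"
    and "XH = 0\<^sub>m r (r * s) @\<^sub>c 0\<^sub>m r r @\<^sub>c XB"
    and "YH = YA @\<^sub>r 0\<^sub>m r r @\<^sub>r 0\<^sub>m (r * t) r"
    and "h = [:0, 1:] \<cdot>\<^sub>m (a * mp_const d0 * b) + mp_const c0"
  shows "(\<forall>z. det (z \<cdot>\<^sub>m DH - H) = det (mp_eval h z)) \<and>
         (\<forall>z. z \<notin> mp_spectrum h \<longrightarrow> XH * mat_inv (z \<cdot>\<^sub>m DH - H) * YH = mat_inv (mp_eval h z))"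
proof -
  note car = assms(4,7,10-13,16-19,22,23)
  define m n where "m = r * s" and "n = r * t"
  define N where "N = m + (r + n)"
  note carm = car[folded m_def n_def]
  have HN: "H \<in> carrier_mat N N" "DH \<in> carrier_mat N N" "XH \<in> carrier_mat r N" "YH \<in> carrier_mat N r"
    unfolding assms(24-27) N_def m_def[symmetric] n_def[symmetric]
    using carm by (intro carrier_matI; simp)+
  have hc: "h \<in> carrier_mat r r" unfolding assms(28) using car by auto
  have mp_eval_h: "mp_eval h z = mp_eval a z * (z \<cdot>\<^sub>m d0) * mp_eval b z + c0" for z
    unfolding assms(28) using car
    by (simp add: mp_eval_add[of _ r r] mp_eval_smult mp_eval_mult[of _ r r _ r]
      mult_smult_distrib[of _ r r _ r] mult_smult_assoc_mat[of _ r r _ r])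
  \<comment> \<open>The pencil as a matrix polynomial, so that its determinant and adjugate are
    polynomial in \<open>z\<close>.\<close>
  define PM where "PM = [:0, 1:] \<cdot>\<^sub>m mp_const DH + mp_const (- H)"
  have PMc: "PM \<in> carrier_mat N N" unfolding PM_def using HN by auto
  have mp_eval_PM: "mp_eval PM z = z \<cdot>\<^sub>m DH - H" for z
    unfolding PM_def using HN
    by (simp add: mp_eval_add[of _ N N] mp_eval_smult minus_add_uminus_mat[of _ N N])
  have finite_spectrum: "finite (mp_spectrum p)" if "det p \<noteq> 0" for p
    unfolding mp_spectrum_def det_mp_eval using that by (rule poly_roots_finite)
  have blk: "z \<cdot>\<^sub>m DH - H = ((z \<cdot>\<^sub>m DA - A) @\<^sub>c 0\<^sub>m m r @\<^sub>c YA * c0 * XB) @\<^sub>r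
      (XA @\<^sub>c z \<cdot>\<^sub>m d0 @\<^sub>c 0\<^sub>m r n) @\<^sub>r (0\<^sub>m n m @\<^sub>c YB @\<^sub>c (z \<cdot>\<^sub>m DB - B))" for z
    unfolding assms(24,25) m_def[symmetric] n_def[symmetric] using carm by (intro pencil_eq_block) auto
  \<comment> \<open>Off both spectra \<open>P\<close> and \<open>Q\<close> are invertible. The
    determinant identity comes first, as it makes the pencil invertible where \<open>det h\<close>
    does not vanish.\<close>
  have generic: "det (mp_eval PM z) = det (mp_eval h z)"
      "det (mp_eval h z) \<noteq> 0 \<Longrightarrow> XH * mat_inv (mp_eval PM z) * YH = mat_inv (mp_eval h z)"
    if z: "z \<notin> mp_spectrum a \<union> mp_spectrum b" for z
  proof -
    let ?P = "z \<cdot>\<^sub>m DA - A" and ?Q = "z \<cdot>\<^sub>m DB - B"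
    have dets: "det (mp_eval a z) \<noteq> 0" "det ?P \<noteq> 0" "det (mp_eval b z) \<noteq> 0" "det ?Q \<noteq> 0"
      using z assms(14,20)[of z] by (auto simp: mp_spectrum_def)
    have Pc: "?P \<in> carrier_mat m m" "?Q \<in> carrier_mat n n" using carm by (simp_all add: minus_carrier_mat)
    have ac: "mp_eval a z \<in> carrier_mat r r" "mp_eval b z \<in> carrier_mat r r" using car by simp_all
    have E: "z \<cdot>\<^sub>m d0 \<in> carrier_mat r r" using car by simp
    note Pi = mat_inv[OF Pc(1) dets(2)] and Qi = mat_inv[OF Pc(2) dets(4)]
    note ai = mat_inv[OF ac(1) dets(1)] and bi = mat_inv[OF ac(2) dets(3)]
    have za: "z \<notin> mp_spectrum a" and zb: "z \<notin> mp_spectrum b" using z by auto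
    note facts = Pc(1) Pi(1) Pc(2) Qi(1) carm(5,6,9,10) ac(1) ai(1) ac(2) bi(1) carm(11) E
      Pi(2) Qi(2) ai(2,3) bi(3) assms(15)[OF za] assms(21)[OF zb] mp_eval_h blk
    show "det (mp_eval PM z) = det (mp_eval h z)"
      unfolding mp_eval_PM by (rule det_block_pencil[OF facts assms(14,20)[symmetric]])
    note det_eq_z = this
    assume h0: "det (mp_eval h z) \<noteq> 0"
    have hz: "mp_eval h z \<in> carrier_mat r r" using hc by simp
    have Mz: "mp_eval PM z \<in> carrier_mat N N" using PMc by simp
    note hi = mat_inv[OF hz h0] and Mi = mat_inv[OF Mz h0[folded det_eq_z]]
    have XY: "XH = 0\<^sub>m r m @\<^sub>c 0\<^sub>m r r @\<^sub>c XB" "YH = YA @\<^sub>r 0\<^sub>m r r @\<^sub>r 0\<^sub>m n r"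
      unfolding assms(26,27) m_def n_def by (rule refl)+
    note solution = block_pencil_solution[OF facts hi(1,2), folded XY N_def mp_eval_PM]
    obtain U where U: "U \<in> carrier_mat N r" "mp_eval PM z * U = YH" "XH * U = mat_inv (mp_eval h z)"
      by (rule that[OF solution(3,1,2)])
    \<comment> \<open>Invertibility of the pencil makes its solution unique, so the explicit
      \<open>U\<close> is the inverse applied to \<open>YH\<close>.\<close>
    have "mat_inv (mp_eval PM z) * YH = mat_inv (mp_eval PM z) * mp_eval PM z * U"
      unfolding U(2)[symmetric] by (rule assoc_mult_mat[OF Mi(1) Mz U(1), symmetric])
    also have "\<dots> = U"
      unfolding Mi(3) using U(1) by (rule left_mult_one_mat)
    finally show "XH * mat_inv (mp_eval PM z) * YH = mat_inv (mp_eval h z)"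
      using U(3) assoc_mult_mat[OF HN(3) Mi(1) HN(4)] by simp
  qed
  have det_eq: "det PM = det h"
    using finite_spectrum[OF assms(6)] finite_spectrum[OF assms(9)] generic(1)
    by (intro poly_eqI_cofinite[of "mp_spectrum a \<union> mp_spectrum b"]) (auto simp: det_mp_eval)
  have det_eval_eq: "det (mp_eval PM z) = det (mp_eval h z)" for z
    by (simp add: det_mp_eval det_eq)
  have "XH * mat_inv (mp_eval PM z) * YH = mat_inv (mp_eval h z)" if z: "z \<notin> mp_spectrum h" for z
  proof -
    \<comment> \<open>Because the determinants agree, both inverses carry the same scalar, and only
      an identity between polynomial matrices remains.\<close>
    have inv_adj: "mat_inv (mp_eval PM w) = (1 / det (mp_eval h w)) \<cdot>\<^sub>m mp_eval (adj_mat PM) w"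
      "mat_inv (mp_eval h w) = (1 / det (mp_eval h w)) \<cdot>\<^sub>m mp_eval (adj_mat h) w"
      "det (mp_eval h w) \<noteq> 0"
      if "w \<notin> mp_spectrum h" for w
      using that mat_inv_eq_adj_mat[of "mp_eval PM w" N] mat_inv_eq_adj_mat[of "mp_eval h w" r] PMc hc
      by (auto simp: mp_spectrum_def det_eval_eq adj_mat_mp_eval)
    note adjc = adj_mat(1)[OF PMc] adj_mat(1)[OF hc]
    have XaY: "XH * (k \<cdot>\<^sub>m mp_eval (adj_mat PM) w) * YH =
        k \<cdot>\<^sub>m mp_eval (mp_const XH * adj_mat PM * mp_const YH) w" for k w
      using HN adjc
      by (simp add: mp_eval_mult[of _ r N _ N] mp_eval_mult[of _ N N _ r] mp_eval_mult[of _ r N _ r]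
        mult_smult_distrib[of _ r N _ N] mult_smult_assoc_mat[of _ r N _ r])
    \<comment> \<open>The given \<open>z\<close> witnesses that \<open>det h\<close> is not the zero
      polynomial, so the spectrum of \<open>h\<close> is finite and may join the exceptional
      set.\<close>
    have "det h \<noteq> 0" using z by (auto simp: mp_spectrum_def det_mp_eval)
    have "mp_const XH * adj_mat PM * mp_const YH = adj_mat h"
    proof (rule mp_eqI_cofinite)
      show "finite (mp_spectrum a \<union> mp_spectrum b \<union> mp_spectrum h)"
        using finite_spectrum assms(6,9) \<open>det h \<noteq> 0\<close> by auto
      fix w assume w: "w \<notin> mp_spectrum a \<union> mp_spectrum b \<union> mp_spectrum h"
      have "(1 / det (mp_eval h w)) \<cdot>\<^sub>m mp_eval (mp_const XH * adj_mat PM * mp_const YH) w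
          = (1 / det (mp_eval h w)) \<cdot>\<^sub>m mp_eval (adj_mat h) w"
        using generic(2)[of w] w inv_adj[of w] by (simp add: XaY)
      \<comment> \<open>Multiplication by the nonzero determinant cancels the common scalar.\<close>
      from arg_cong[OF this, of "\<lambda>A. det (mp_eval h w) \<cdot>\<^sub>m A"]
      show "mp_eval (mp_const XH * adj_mat PM * mp_const YH) w = mp_eval (adj_mat h) w"
        using inv_adj(3)[of w] w by (auto intro!: eq_matI simp: mat_eq_iff)
    qed (use HN adjc in auto)
    thus ?thesis using inv_adj[OF z] by (simp add: XaY)
  qed
  thus ?thesis using det_eval_eq by (simp add: mp_eval_PM)
qed

end
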